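(* The relation $G<_e H$ does not necessarily imply $G<_s H$, and the relation $G<_s H$ does not necessarily imply $G<_e H$. That is: (1) there exist $n$ and connected graphs $G,H$ on $n$ vertices with $G<_e H$ but not $G<_s H$; and (2) there exist $n$ and connected graphs $G,H$ on $n$ vertices with $G<_s H$ but not $G<_e H$.
   Context: All graphs are finite and simple. The chromatic symmetric function of a graph $G$ with vertices $v_1,\dots,v_n$ is $X_G=\sum_{\kappa}x_{\kappa(v_1)}\cdots x_{\kappa(v_n)}$, summed over all proper colorings $\kappa:V(G)\to\{1,2,3,\dots\}$; it is a homogeneous symmetric function of degree $n$ over $\mathbb{Q}$. Let $e_\lambda=e_{\lambda_1}e_{\lambda_2}\cdots$ be the elementary symmetric functions and $s_\lambda$ the Schur symmetric functions, two bases of the algebra of symmetric functions; $[e_\lambda]F$ and $[s_\lambda]F$ denote the coefficients of $F$ in these bases, and $F$ is $e$-positive (respectively Schur-positive) if all $[e_\lambda]F\ge0$ (respectively all $[s_\lambda]F\ge 0$). For connected graphs $G,H$ on $n$ vertices (for which the coefficients of $e_{(n)}$ and $s_{(1^n)}$ in $X_G$, $X_H$ are positive), set $$X_e(G,H)=X_G-\frac{[e_{(n)}]X_G}{[e_{(n)}]X_H}X_H,\qquad X_s(G,H)=X_G-\frac{[s_{(1^n)}]X_G}{[s_{(1^n)}]X_H}X_H.$$ Write $G\geq_e H$ (equivalently $H\le_e G$) if $X_e(G,H)$ is $e$-positive, and $G\geq_s H$ (equivalently $H\le_s G$) if $X_s(G,H)$ is Schur-positive. Strict relations $<_e$, $<_s$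 mean that the weak relation holds and $X_G\neq X_H$. *)

theory Defs
  imports
    "HOL.Rat"
    "HOL-Library.Multiset"
    "HOL-Library.FuncSet"
    "Graph_Theory.Pair_Digraph"
    "Graph_Theory.Digraph_Component"
begin

text \<open>
  A formal power series over the rationals in the commuting variables $x_1, x_2, \dots$ is the
  function assigning to every monomial its coefficient. The monomial
  $x_{i_1} \cdots x_{i_n}$ is the multiset of its indices $i_1, \dots, i_n \geq 1$;
  all series defined below vanish on multisets containing 0.
\<close>

type_synonym series = "nat multiset \<Rightarrow> rat"

definition series_one :: series where
  "series_one M = of_bool (M = {#})"

definition series_mult :: "series \<Rightarrow> series \<Rightarrow> series" where
  "series_mult F G M = (\<Sum>A | A \<subseteq># M. F A * G (M - A))"

subsection \<open>Elementary symmetric functions and Schur functions\<close>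

definition is_partition :: "nat list \<Rightarrow> bool" where
  "is_partition \<mu> \<longleftrightarrow> sorted_wrt (\<ge>) \<mu> \<and> (\<forall>k \<in> set \<mu>. k > 0)"

definition elem :: "nat \<Rightarrow> series" where
  "elem k M = of_bool (\<exists>S. S \<subseteq> {1..} \<and> finite S \<and> card S = k \<and> M = mset_set S)"

definition elem_sym :: "nat list \<Rightarrow> series" where
  "elem_sym \<mu> = foldr series_mult (map elem \<mu>) series_one"

text \<open>
  Schur functions are generating functions of semistandard Young tableaux. Rows and columns are
  numbered from 0, and a tableau is undefined outside its diagram, so that the tableaux of a given
  shape and content form a finite set.
\<close>

definition diagram :: "nat list \<Rightarrow> (nat \<times> nat) set" where
  "diagram \<mu> = {(i, j). i < length \<mu> \<and> j < \<mu> ! i}"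

definition ssyt :: "nat list \<Rightarrow> (nat \<times> nat \<Rightarrow> nat) set" where
  "ssyt \<mu> = {T \<in> diagram \<mu> \<rightarrow>\<^sub>E {1..}.
     (\<forall>i j j'. j < j' \<and> (i, j') \<in> diagram \<mu> \<longrightarrow> T (i, j) \<le> T (i, j')) \<and>
     (\<forall>i i' j. i < i' \<and> (i', j) \<in> diagram \<mu> \<longrightarrow> T (i, j) < T (i', j))}"

definition schur :: "nat list \<Rightarrow> series" where
  "schur \<mu> M = of_nat (card {T \<in> ssyt \<mu>. image_mset T (mset_set (diagram \<mu>)) = M})"

subsection \<open>Coefficients in a basis\<close>

text \<open>
  Here \<^term>\<open>b\<close> is a family indexed by the partitions. For the two bases considered, a symmetric
  function has exactly one expansion.
\<close>

definition expansion :: "(nat list \<Rightarrow> series) \<Rightarrow> series \<Rightarrow> (nat list \<Rightarrow> rat) \<Rightarrow> bool" where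
  "expansion b F c \<longleftrightarrow> finite {\<mu>. c \<mu> \<noteq> 0} \<and> {\<mu>. c \<mu> \<noteq> 0} \<subseteq> Collect is_partition \<and>
     F = (\<lambda>M. \<Sum>\<mu> | c \<mu> \<noteq> 0. c \<mu> * b \<mu> M)"

definition coefficient :: "(nat list \<Rightarrow> series) \<Rightarrow> nat list \<Rightarrow> series \<Rightarrow> rat" where
  "coefficient b \<mu> F = (THE c. expansion b F c) \<mu>"

definition positive_in :: "(nat list \<Rightarrow> series) \<Rightarrow> series \<Rightarrow> bool" where
  "positive_in b F \<longleftrightarrow> (\<forall>\<mu>. is_partition \<mu> \<longrightarrow> coefficient b \<mu> F \<ge> 0)"

abbreviation "e_coeff \<equiv> coefficient elem_sym"
abbreviation "s_coeff \<equiv> coefficient schur"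
abbreviation "e_positive \<equiv> positive_in elem_sym"
abbreviation "schur_positive \<equiv> positive_in schur"

subsection \<open>Chromatic symmetric functions\<close>

text \<open>
  A finite simple graph is a \<^const>\<open>pair_graph\<close>: a finite, loop-free digraph whose set of arcs
  is symmetric, an edge being a pair of opposite arcs.
\<close>

definition connected_graph_on :: "nat \<Rightarrow> 'a pair_pre_digraph \<Rightarrow> bool" where
  "connected_graph_on n G \<longleftrightarrow>
     pair_graph G \<and> Digraph_Component.connected (with_proj G) \<and> card (pverts G) = n"

definition proper_colorings :: "'a pair_pre_digraph \<Rightarrow> ('a \<Rightarrow> nat) set" where
  "proper_colorings G =
     {\<kappa> \<in> pverts G \<rightarrow>\<^sub>E {1..}. \<forall>(u, v) \<in> parcs G. \<kappa> u \<noteq> \<kappa> v}"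

definition chromatic_sym :: "'a pair_pre_digraph \<Rightarrow> series" where
  "chromatic_sym G M =
     of_nat (card {\<kappa> \<in> proper_colorings G. image_mset \<kappa> (mset_set (pverts G)) = M})"

subsection \<open>The two relations\<close>

text \<open>The following are meant for connected graphs with equally many vertices.\<close>

definition X_e :: "'a pair_pre_digraph \<Rightarrow> 'b pair_pre_digraph \<Rightarrow> series" where
  "X_e G H = (let n = card (pverts G) in
     (\<lambda>M. chromatic_sym G M -
        e_coeff [n] (chromatic_sym G) / e_coeff [n] (chromatic_sym H) * chromatic_sym H M))"

definition X_s :: "'a pair_pre_digraph \<Rightarrow> 'b pair_pre_digraph \<Rightarrow> series" where
  "X_s G H = (let n = card (pverts G) in
     (\<lambda>M. chromatic_sym G M -
        s_coeff (replicate n 1) (chromatic_sym G) / s_coeff (replicate n 1) (chromatic_sym H)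
          * chromatic_sym H M))"

definition le_e :: "'a pair_pre_digraph \<Rightarrow> 'b pair_pre_digraph \<Rightarrow> bool"  (infix "\<le>\<^sub>e" 50) where
  "G \<le>\<^sub>e H \<longleftrightarrow> e_positive (X_e H G)"

definition le_s :: "'a pair_pre_digraph \<Rightarrow> 'b pair_pre_digraph \<Rightarrow> bool"  (infix "\<le>\<^sub>s" 50) where
  "G \<le>\<^sub>s H \<longleftrightarrow> schur_positive (X_s H G)"

definition less_e :: "'a pair_pre_digraph \<Rightarrow> 'b pair_pre_digraph \<Rightarrow> bool"  (infix "<\<^sub>e" 50) where
  "G <\<^sub>e H \<longleftrightarrow> G \<le>\<^sub>e H \<and> chromatic_sym G \<noteq> chromatic_sym H"

definition less_s :: "'a pair_pre_digraph \<Rightarrow> 'b pair_pre_digraph \<Rightarrow> bool"  (infix "<\<^sub>s" 50) where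
  "G <\<^sub>s H \<longleftrightarrow> G \<le>\<^sub>s H \<and> chromatic_sym G \<noteq> chromatic_sym H"

end

theory Submission
  imports Defs
begin

text \<open>
  The witnesses are the house and the diamond with a pendant edge at a vertex of degree 2
  (below: flag) for the first part, and the diamond and the 4-cycle for the second part:
  \<^item> house: $30e_5 + 6e_{41} + 6e_{32} = 6s_{221} + 12s_{2111} + 42s_{11111}$,
  \<^item> flag: $20e_5 + 12e_{41} + 4e_{32} = 4s_{221} + 16s_{2111} + 36s_{11111}$,
  \<^item> diamond: $16e_4 + 2e_{31} = 2s_{211} + 18s_{1111}$,
  \<^item> 4-cycle: $12e_4 + 2e_{22} = 2s_{22} + 2s_{211} + 14s_{1111}$.

  Expansions in either basis are unique by triangularity with respect to the dominance order.
  To verify them, note that the coefficient of $x^M$ in a chromatic, elementary or Schur function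
  counts the arrangements of $M$ into a list satisfying some order constraints between its entries.
  This number depends on $M$ only through the order of its elements, so that an identity between such
  series of degree $n$ needs to be checked for $2^{n-1}$ multisets only.
\<close>

section \<open>Uniqueness of expansions\<close>

lemma expansion_sum_superset:
  assumes "expansion b F c" "finite S" "{\<mu>. c \<mu> \<noteq> 0} \<subseteq> S"
  shows "F M = (\<Sum>\<mu>\<in>S. c \<mu> * b \<mu> M)"
proof -
  have "F M = (\<Sum>\<mu> | c \<mu> \<noteq> 0. c \<mu> * b \<mu> M)"
    using assms(1) by (simp add: expansion_def)
  also have "\<dots> = (\<Sum>\<mu>\<in>S. c \<mu> * b \<mu> M)"
    by (rule sum.mono_neutral_left) (use assms in auto)
  finally show ?thesis .
qed

lemma expansion_superset:
  assumes "finite S" "S \<subseteq> Collect is_partition" "{\<mu>. c \<mu> \<noteq> 0} \<subseteq> S"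
    and "\<And>M. F M = (\<Sum>\<mu>\<in>S. c \<mu> * b \<mu> M)"
  shows "expansion b F c"
proof -
  have "(\<Sum>\<mu> | c \<mu> \<noteq> 0. c \<mu> * b \<mu> M) = (\<Sum>\<mu>\<in>S. c \<mu> * b \<mu> M)" for M
    by (rule sum.mono_neutral_left) (use assms in auto)
  then have "F = (\<lambda>M. \<Sum>\<mu> | c \<mu> \<noteq> 0. c \<mu> * b \<mu> M)"
    using assms(4) by presburger
  moreover have "finite {\<mu>. c \<mu> \<noteq> 0}"
    using assms(1,3) finite_subset by blast
  ultimately show ?thesis
    using assms(2,3) unfolding expansion_def by blast
qed

lemma expansion_diff:
  assumes "expansion b F c" "expansion b G d"
  shows "expansion b (\<lambda>M. F M - r * G M) (\<lambda>\<mu>. c \<mu> - r * d \<mu>)"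
proof (rule expansion_superset)
  let ?S = "{\<mu>. c \<mu> \<noteq> 0} \<union> {\<mu>. d \<mu> \<noteq> 0}"
  show fin: "finite ?S" and "?S \<subseteq> Collect is_partition"
    using assms by (auto simp: expansion_def)
  show "{\<mu>. c \<mu> - r * d \<mu> \<noteq> 0} \<subseteq> ?S"
    by auto
  show "F M - r * G M = (\<Sum>\<mu>\<in>?S. (c \<mu> - r * d \<mu>) * b \<mu> M)" for M
    using expansion_sum_superset[OF assms(1) fin] expansion_sum_superset[OF assms(2) fin]
    by (simp add: algebra_simps sum_subtractf sum_distrib_left)
qed

text \<open>The statistic \<open>p\<close> embeds the partitions of all sizes into the functions
  \<open>nat \<Rightarrow> nat\<close>, whose pointwise order serves as the partial order on
  partitions. \<open>L \<mu>\<close> is the leading monomial of \<open>b \<mu>\<close>.\<close>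

definition triangular :: "(nat list \<Rightarrow> series) \<Rightarrow> bool" where
  "triangular b \<longleftrightarrow> (\<exists>(p :: nat list \<Rightarrow> nat \<Rightarrow> nat) L. inj_on p (Collect is_partition) \<and>
     (\<forall>\<mu>. is_partition \<mu> \<longrightarrow> b \<mu> (L \<mu>) \<noteq> 0 \<and>
       (\<forall>\<nu>. is_partition \<nu> \<and> b \<nu> (L \<mu>) \<noteq> 0 \<longrightarrow> p \<mu> \<le> p \<nu>)))"

text \<open>Take \<mu> in the support of \<open>c\<close> with \<open>p \<mu>\<close> maximal. At
  the monomial \<open>L \<mu>\<close> all other terms vanish, so
  \<open>c \<mu> * b \<mu> (L \<mu>)\<close> is 0 although both factors are nonzero.\<close>

lemma expansion_zero:
  assumes "triangular b" "expansion b (\<lambda>M. 0) c"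
  shows "c = (\<lambda>\<mu>. 0)"
proof (rule ccontr)
  obtain p :: "nat list \<Rightarrow> nat \<Rightarrow> nat" and L where inj: "inj_on p (Collect is_partition)"
    and L: "\<And>\<mu>. is_partition \<mu> \<Longrightarrow> b \<mu> (L \<mu>) \<noteq> 0"
    and p: "\<And>\<mu> \<nu>. is_partition \<mu> \<Longrightarrow> is_partition \<nu> \<Longrightarrow> b \<nu> (L \<mu>) \<noteq> 0 \<Longrightarrow> p \<mu> \<le> p \<nu>"
    using assms(1) unfolding triangular_def by metis
  let ?S = "{\<mu>. c \<mu> \<noteq> 0}"
  have S: "finite ?S" "?S \<subseteq> Collect is_partition"
    and zero: "(\<Sum>\<mu>\<in>?S. c \<mu> * b \<mu> M) = 0" for M
    using assms(2) by (auto simp: expansion_def fun_eq_iff)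
  assume "c \<noteq> (\<lambda>\<mu>. 0)"
  then have "?S \<noteq> {}"
    by auto
  \<comment> \<open>The pointwise order is only partial, so a maximal element of the image of the
    support is chosen rather than a greatest one.\<close>
  then obtain \<mu> where \<mu>: "\<mu> \<in> ?S" and max: "\<And>\<nu>. \<nu> \<in> ?S \<Longrightarrow> p \<mu> \<le> p \<nu> \<Longrightarrow> p \<nu> = p \<mu>"
    using finite_has_maximal[of "p ` ?S"] S(1) by fastforce
  have "c \<nu> * b \<nu> (L \<mu>) = 0" if "\<nu> \<in> ?S - {\<mu>}" for \<nu>
  proof (rule ccontr)
    assume "c \<nu> * b \<nu> (L \<mu>) \<noteq> 0"
    then have "p \<nu> = p \<mu>"
      using that \<mu> S(2) by (intro max p) auto
    then show False
      using that \<mu> S(2) inj by (auto dest!: inj_onD)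
  qed
  then have "(\<Sum>\<nu>\<in>?S. c \<nu> * b \<nu> (L \<mu>)) = c \<mu> * b \<mu> (L \<mu>)"
    using \<mu> S(1) by (subst sum.remove[of _ \<mu>]) (auto intro: sum.neutral)
  then show False
    using \<mu> S(2) L zero by auto
qed

text \<open>The difference of two expansions of \<open>F\<close> expands the zero series, hence the
  definite description in \<open>coefficient\<close> denotes \<open>c\<close>.\<close>

lemma coefficient_eq:
  assumes "triangular b" "expansion b F c"
  shows "coefficient b \<mu> F = c \<mu>"
proof -
  have "d = c" if "expansion b F d" for d
    using expansion_zero[OF assms(1), of "\<lambda>\<mu>. d \<mu> - 1 * c \<mu>"] expansion_diff[OF that assms(2), of 1]
    by (simp add: fun_eq_iff)
  then show ?thesis
    using assms(2) unfolding coefficient_def by (metis the_equality)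
qed

text \<open>An expansion vanishes outside the partitions, so the sign condition may be quantified
  over all lists.\<close>

lemma positive_in_iff:
  assumes "triangular b" "expansion b F c"
  shows "positive_in b F \<longleftrightarrow> (\<forall>\<mu>. c \<mu> \<ge> 0)"
proof -
  have "c \<mu> = 0" if "\<not> is_partition \<mu>" for \<mu>
    using assms(2) that by (auto simp: expansion_def)
  then have "(\<forall>\<mu>. is_partition \<mu> \<longrightarrow> c \<mu> \<ge> 0) \<longleftrightarrow> (\<forall>\<mu>. c \<mu> \<ge> 0)"
    by (metis order_refl)
  then show ?thesis
    using coefficient_eq[OF assms] by (simp add: positive_in_def)
qed

section \<open>Triangularity of the elementary symmetric functions\<close>

lemma is_partition_eqI:
  assumes "is_partition \<mu>" "is_partition \<nu>"
    and "\<And>k. size (filter_mset (\<lambda>m. k < m) (mset \<mu>)) = size (filter_mset (\<lambda>m. k < m) (mset \<nu>))"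
  shows "\<mu> = \<nu>"
proof -
  \<comment> \<open>The numbers of parts exceeding \<open>k\<close> are the parts of the conjugate
    partition; consecutive ones differ by the multiplicity of \<open>Suc k\<close>.\<close>
  have split: "size (filter_mset (\<lambda>m. k < m) N) = count N (Suc k) + size (filter_mset (\<lambda>m. Suc k < m) N)"
    for N k
    by (induction N) auto
  have "count (mset \<mu>) k = count (mset \<nu>) k" for k
  proof (cases k)
    case 0
    then show ?thesis
      using assms(1,2) by (metis count_mset_0_iff is_partition_def less_irrefl)
  next
    case (Suc j)
    then show ?thesis
      using assms(3)[of j] assms(3)[of "Suc j"] split[of j] by simp
  qed
  then have eq: "mset (rev \<mu>) = mset (rev \<nu>)"
    by (simp add: multiset_eq_iff)
  have "sorted (rev \<mu>)" "sorted (rev \<nu>)"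
    using assms(1,2) by (simp_all add: is_partition_def sorted_wrt_rev)
  then have "rev \<mu> = rev \<nu>"
    using eq by (metis properties_for_sort)
  then show ?thesis by simp
qed

text \<open>Finiteness matters because a sum over an infinite index set is 0 by convention. The
  induction separates the submultisets that contain \<open>x\<close> from those that do not.\<close>

lemma finite_submultisets: "finite {A. A \<subseteq># M}"
proof (induction M)
  case (add x M)
  have "{A. A \<subseteq># add_mset x M} \<subseteq> {A. A \<subseteq># M} \<union> add_mset x ` {A. A \<subseteq># M}"
  proof
    fix A assume "A \<in> {A. A \<subseteq># add_mset x M}"
    then have sub: "A \<subseteq># add_mset x M" by simp
    show "A \<in> {A. A \<subseteq># M} \<union> add_mset x ` {A. A \<subseteq># M}"
    proof (cases "x \<in># A")
      case True
      then obtain B where "A = add_mset x B" by (metis mset_add)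
      with sub show ?thesis by simp
    next
      case False
      have "count A a \<le> count M a" for a
        using False mset_subset_eq_count[OF sub, of a] by (cases "a = x") (auto simp: not_in_iff)
      then have "A \<subseteq># M" by (rule mset_subset_eqI)
      then show ?thesis by simp
    qed
  qed
  then show ?case
    using add.IH finite_subset by blast
qed simp

lemma series_mult_nonneg:
  "(\<And>A. F A \<ge> 0) \<Longrightarrow> (\<And>A. G A \<ge> 0) \<Longrightarrow> series_mult F G M \<ge> 0"
  unfolding series_mult_def by (intro sum_nonneg mult_nonneg_nonneg) auto

text \<open>With nonnegative coefficients nothing cancels, and the splitting of \<open>A + B\<close>
  into \<open>A\<close> and \<open>B\<close> contributes a positive term.\<close>

lemma series_mult_pos:
  assumes "\<And>A. F A \<ge> 0" "\<And>A. G A \<ge> 0" "F A > 0" "G B > 0"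
  shows "series_mult F G (A + B) > 0"
  unfolding series_mult_def
proof (rule sum_pos2[OF finite_submultisets, where i = A])
  show "F A * G (A + B - A) > 0"
    using assms(3,4) by simp
  show "F A' * G (A + B - A') \<ge> 0" for A'
    using assms(1,2) by simp
qed simp

lemma elem_sym_Nil: "elem_sym [] = series_one"
  and elem_sym_Cons: "elem_sym (k # \<mu>) = series_mult (elem k) (elem_sym \<mu>)"
  by (simp_all add: elem_sym_def)

lemma elem_sym_nonneg: "elem_sym \<mu> M \<ge> 0"
proof (induction \<mu> arbitrary: M)
  case Nil
  then show ?case by (simp add: elem_sym_Nil series_one_def)
next
  case (Cons k \<mu>)
  then show ?case
    unfolding elem_sym_Cons by (intro series_mult_nonneg) (auto simp: elem_def)
qed

text \<open>Each factor \<open>elem k\<close> contributes the monomial x_1 ... x_k.\<close>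

lemma elem_sym_columns_pos: "elem_sym \<mu> (sum_list (map (\<lambda>k. mset_set {1..k}) \<mu>)) > 0"
proof (induction \<mu>)
  case Nil
  then show ?case by (simp add: elem_sym_Nil series_one_def)
next
  case (Cons k \<mu>)
  have "\<exists>S. S \<subseteq> {1..} \<and> finite S \<and> card S = k \<and> mset_set {Suc 0..k} = mset_set S"
    by (rule exI[of _ "{1..k}"]) auto
  then have "elem k (mset_set {1..k}) > 0"
    by (simp add: elem_def)
  then show ?case
    using Cons elem_sym_nonneg unfolding elem_sym_Cons list.map sum_list.Cons
    by (intro series_mult_pos) (auto simp: elem_def)
qed

lemma card_inter_le_min:
  assumes "S \<subseteq> {1..}" "finite S"
  shows "card {x\<in>S. x \<le> k} \<le> min (card S) k"
proof -
  have "card {x\<in>S. x \<le> k} \<le> card {1..k}"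
    by (rule card_mono) (use assms in auto)
  moreover have "card {x\<in>S. x \<le> k} \<le> card S"
    by (rule card_mono) (use assms in auto)
  ultimately show ?thesis by simp
qed

text \<open>A monomial of \<open>elem m\<close> is squarefree of degree \<open>m\<close>, so at most
  \<open>min m k\<close> of its indices are at most \<open>k\<close>. These bounds add up over the
  factors.\<close>

lemma elem_sym_support:
  assumes "elem_sym \<nu> M \<noteq> 0"
  shows "size (filter_mset (\<lambda>x. x \<le> k) M) \<le> sum_list (map (\<lambda>m. min m k) \<nu>)"
  using assms
proof (induction \<nu> arbitrary: M)
  case Nil
  then show ?case by (simp add: elem_sym_Nil series_one_def)
next
  case (Cons m \<nu>)
  then obtain A where A: "A \<subseteq># M" "elem m A * elem_sym \<nu> (M - A) \<noteq> 0"
    unfolding elem_sym_Cons series_mult_def by (metis (mono_tags, lifting) mem_Collect_eq sum.neutral)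
  then obtain S where S: "S \<subseteq> {1..}" "finite S" "card S = m" "A = mset_set S"
    by (auto simp: elem_def of_bool_def split: if_splits)
  then have "size (filter_mset (\<lambda>x. x \<le> k) A) \<le> min m k"
    using card_inter_le_min[of S k] by simp
  moreover have "size (filter_mset (\<lambda>x. x \<le> k) (M - A)) \<le> sum_list (map (\<lambda>m. min m k) \<nu>)"
    using A(2) by (intro Cons.IH) auto
  moreover have "size (filter_mset (\<lambda>x. x \<le> k) M) =
      size (filter_mset (\<lambda>x. x \<le> k) A) + size (filter_mset (\<lambda>x. x \<le> k) (M - A))"
    using A(1) by (metis filter_union_mset size_union subset_mset.add_diff_inverse)
  ultimately show ?case
    unfolding list.map sum_list.Cons by linarith
qed

text \<open>The leading monomial of $e_\mu$ is $x^{\mu'}$, and the statistic is the sequence of partial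
  sums of the conjugate partition.\<close>

lemma triangular_elem_sym: "triangular elem_sym"
proof -
  define p :: "nat list \<Rightarrow> nat \<Rightarrow> nat" where "p = (\<lambda>\<mu> k. sum_list (map (\<lambda>m. min m k) \<mu>))"
  define L :: "nat list \<Rightarrow> nat multiset" where "L = (\<lambda>\<mu>. sum_list (map (\<lambda>k. mset_set {1..k}) \<mu>))"
  \<comment> \<open>\<open>min m (Suc k)\<close> exceeds \<open>min m k\<close> by one exactly if
    \<open>k < m\<close>, so the increments of \<open>p \<mu>\<close> are the numbers that determine
    \<mu> by \<open>is_partition_eqI\<close>.\<close>
  have p_Suc: "p \<mu> (Suc k) = p \<mu> k + size (filter_mset (\<lambda>m. k < m) (mset \<mu>))" for \<mu> k
    by (induction \<mu>) (auto simp: p_def)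
  have "inj_on p (Collect is_partition)"
  proof (rule inj_onI)
    fix \<mu> \<nu> assume "\<mu> \<in> Collect is_partition" "\<nu> \<in> Collect is_partition" "p \<mu> = p \<nu>"
    then show "\<mu> = \<nu>"
      using p_Suc by (intro is_partition_eqI) (auto, metis add_left_cancel)
  qed
  \<comment> \<open>For \<open>L \<mu>\<close> the count bounded in \<open>elem_sym_support\<close>
    is exactly \<open>p \<mu> k\<close>, so the occurrence of \<open>L \<mu>\<close> in
    \<open>elem_sym \<nu>\<close> yields \<open>p \<mu> \<le> p \<nu>\<close>.\<close>
  moreover have size_L: "size (filter_mset (\<lambda>x. x \<le> k) (L \<mu>)) = p \<mu> k" for \<mu> k
  proof (induction \<mu>)
    case (Cons m \<mu>)
    have "{x \<in> {Suc 0..m}. x \<le> k} = {Suc 0..min m k}" by auto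
    with Cons show ?case by (simp add: L_def p_def)
  qed (simp add: L_def p_def)
  moreover have "p \<mu> \<le> p \<nu>" if "elem_sym \<nu> (L \<mu>) \<noteq> 0" for \<mu> \<nu>
    using elem_sym_support[OF that] by (simp add: size_L p_def[symmetric] le_fun_def) (simp add: p_def)
  moreover have "elem_sym \<mu> (L \<mu>) \<noteq> 0" for \<mu>
    using elem_sym_columns_pos[of \<mu>] by (simp add: L_def)
  ultimately show ?thesis
    unfolding triangular_def by blast
qed

section \<open>Triangularity of the Schur functions\<close>

lemma finite_diagram: "finite (diagram \<mu>)"
proof -
  have "diagram \<mu> = (SIGMA i:{..<length \<mu>}. {..<\<mu> ! i})"
    by (auto simp: diagram_def)
  then show ?thesis by simp
qed

text \<open>The values of such a function lie in \<open>M\<close>, and it is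
  \<open>undefined\<close> outside \<open>D\<close>. Finiteness matters since an infinite set has
  \<open>card\<close> 0.\<close>

lemma finite_PiE_image_mset:
  assumes "finite D"
  shows "finite {f \<in> D \<rightarrow>\<^sub>E B. image_mset f (mset_set D) = M}"
proof (rule finite_subset)
  show "{f \<in> D \<rightarrow>\<^sub>E B. image_mset f (mset_set D) = M} \<subseteq> D \<rightarrow>\<^sub>E set_mset M"
    using assms by (fastforce simp: PiE_iff extensional_def)
  show "finite (D \<rightarrow>\<^sub>E set_mset M)"
    using assms by (simp add: finite_PiE)
qed

lemma diagram_up:
  assumes "is_partition \<mu>" "(i', j) \<in> diagram \<mu>" "i < i'"
  shows "(i, j) \<in> diagram \<mu>"
proof -
  have i': "i' < length \<mu>" "j < \<mu> ! i'"
    using assms(2) by (simp_all add: diagram_def)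
  then have "\<mu> ! i' \<le> \<mu> ! i"
    using assms(1,3) sorted_wrt_nth_less[of _ \<mu> i i'] unfolding is_partition_def by blast
  with i' assms(3) show ?thesis
    by (simp add: diagram_def)
qed

text \<open>Down a column the entries start at 1 or more and grow by at least 1 per row. This
  confines the entries up to \<open>k\<close> to the first \<open>k\<close> rows, which gives the
  dominance inequality.\<close>

lemma ssyt_row_less:
  assumes "is_partition \<mu>" "T \<in> ssyt \<mu>" "(i, j) \<in> diagram \<mu>"
  shows "i < T (i, j)"
  using assms(3)
proof (induction i)
  case 0
  then have "T (0, j) \<in> {1..}"
    using assms(2) by (auto simp: ssyt_def dest: PiE_mem)
  then show ?case by simp
next
  case (Suc i)
  then have "i < T (i, j)"
    using diagram_up[OF assms(1)] by blast
  moreover have "T (i, j) < T (Suc i, j)"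
    using Suc.prems assms(2) by (auto simp: ssyt_def)
  ultimately show ?case by simp
qed

text \<open>The leading monomial of $s_\mu$ is $x^\mu$, the content of the tableau below, and the
  statistic is the sequence of partial sums of $\mu$.\<close>

definition row_tableau :: "nat list \<Rightarrow> nat \<times> nat \<Rightarrow> nat" where
  "row_tableau \<mu> = (\<lambda>(i, j)\<in>diagram \<mu>. Suc i)"

lemma triangular_schur: "triangular schur"
proof -
  define p :: "nat list \<Rightarrow> nat \<Rightarrow> nat" where "p = (\<lambda>\<mu> k. card {d \<in> diagram \<mu>. fst d < k})"
  define L where "L = (\<lambda>\<mu>. image_mset (row_tableau \<mu>) (mset_set (diagram \<mu>)))"
  have row: "card {d \<in> diagram \<mu>. fst d = k} = (if k < length \<mu> then \<mu> ! k else 0)" for \<mu> k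
  proof -
    have "{d \<in> diagram \<mu>. fst d = k} = (if k < length \<mu> then Pair k ` {..<\<mu> ! k} else {})"
      by (auto simp: diagram_def)
    then show ?thesis by (auto simp: card_image inj_on_def)
  qed
  have p_Suc: "p \<mu> (Suc k) = p \<mu> k + (if k < length \<mu> then \<mu> ! k else 0)" for \<mu> k
  proof -
    have "{d \<in> diagram \<mu>. fst d < Suc k} = {d \<in> diagram \<mu>. fst d < k} \<union> {d \<in> diagram \<mu>. fst d = k}"
      by auto
    then have "p \<mu> (Suc k) = card ({d \<in> diagram \<mu>. fst d < k} \<union> {d \<in> diagram \<mu>. fst d = k})"
      by (simp add: p_def)
    also have "\<dots> = p \<mu> k + card {d \<in> diagram \<mu>. fst d = k}"
      unfolding p_def by (rule card_Un_disjoint) (auto simp: finite_diagram)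
    finally show ?thesis by (simp only: row)
  qed
  have "inj_on p (Collect is_partition)"
  proof (rule inj_onI)
    fix \<mu> \<nu> assume part: "\<mu> \<in> Collect is_partition" "\<nu> \<in> Collect is_partition" and eq: "p \<mu> = p \<nu>"
    \<comment> \<open>Padded with zeros, the parts are the increments of \<open>p\<close>. As
      genuine parts are positive, the padding also reveals the length.\<close>
    have parts: "(if k < length \<mu> then \<mu> ! k else 0) = (if k < length \<nu> then \<nu> ! k else 0)" for k
      using p_Suc[of \<mu> k] p_Suc[of \<nu> k] eq by simp
    have iff: "k < length \<mu> \<longleftrightarrow> k < length \<nu>" for k
    proof -
      have "k < length \<mu> \<Longrightarrow> 0 < \<mu> ! k" "k < length \<nu> \<Longrightarrow> 0 < \<nu> ! k"
        using part nth_mem[of k \<mu>] nth_mem[of k \<nu>] unfolding is_partition_def by blast+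
      with parts[of k] show ?thesis
        by (metis less_irrefl)
    qed
    then have "length \<mu> = length \<nu>"
      by (meson linorder_neq_iff)
    then show "\<mu> = \<nu>"
      by (rule nth_equalityI) (use parts iff in \<open>metis\<close>)
  qed
  moreover have "schur \<mu> (L \<mu>) \<noteq> 0" if "is_partition \<mu>" for \<mu>
  proof -
    have "row_tableau \<mu> \<in> {T \<in> ssyt \<mu>. image_mset T (mset_set (diagram \<mu>)) = L \<mu>}"
      using diagram_up[OF that] by (auto simp: L_def ssyt_def row_tableau_def diagram_def)
    moreover have "finite {T \<in> ssyt \<mu>. image_mset T (mset_set (diagram \<mu>)) = L \<mu>}"
      by (rule finite_subset[OF _ finite_PiE_image_mset[OF finite_diagram[of \<mu>], of "{1..}" "L \<mu>"]])
        (auto simp: ssyt_def)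
    ultimately show ?thesis
      by (auto simp: schur_def)
  qed
  moreover have "p \<mu> \<le> p \<nu>" if part: "is_partition \<nu>" and nz: "schur \<nu> (L \<mu>) \<noteq> 0" for \<mu> \<nu>
  proof (rule le_funI)
    fix k
    have "{T \<in> ssyt \<nu>. image_mset T (mset_set (diagram \<nu>)) = L \<mu>} \<noteq> {}"
      using nz unfolding schur_def by (metis card.empty of_nat_0)
    then obtain T where T: "T \<in> ssyt \<nu>" "image_mset T (mset_set (diagram \<nu>)) = L \<mu>"
      by blast
    have size: "size (filter_mset (\<lambda>x. x \<le> k) (image_mset f (mset_set D))) = card {d \<in> D. f d \<le> k}"
      if "finite D" for f :: "nat \<times> nat \<Rightarrow> nat" and D
      using that by (simp add: filter_mset_image_mset)
    have fst_less: "fst d < k" if "d \<in> diagram \<nu>" "T d \<le> k" for d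
      using ssyt_row_less[OF part T(1), of "fst d" "snd d"] that by simp
    have "p \<mu> k = card {d \<in> diagram \<mu>. row_tableau \<mu> d \<le> k}"
      unfolding p_def by (rule arg_cong[of _ _ card]) (auto simp: row_tableau_def)
    also have "\<dots> = size (filter_mset (\<lambda>x. x \<le> k) (L \<mu>))"
      unfolding L_def by (simp add: size finite_diagram)
    also have "\<dots> = card {d \<in> diagram \<nu>. T d \<le> k}"
      unfolding T(2)[symmetric] by (simp add: size finite_diagram)
    also have "\<dots> \<le> p \<nu> k"
      unfolding p_def using fst_less finite_diagram by (intro card_mono) auto
    finally show "p \<mu> k \<le> p \<nu> k" .
  qed
  ultimately show ?thesis
    unfolding triangular_def by blast
qed

section \<open>Lists with order constraints\<close>

text \<open>\<open>Lt\<close> serves the columns of tableaux and the factors \<open>elem k\<close>,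
  \<open>Le\<close> the rows of tableaux, and \<open>Ne\<close> the edges of a graph.\<close>

datatype comparison = Lt | Le | Ne

fun holds :: "comparison \<Rightarrow> nat \<Rightarrow> nat \<Rightarrow> bool" where
  "holds Lt x y \<longleftrightarrow> x < y"
| "holds Le x y \<longleftrightarrow> x \<le> y"
| "holds Ne x y \<longleftrightarrow> x \<noteq> y"

type_synonym constraints = "(nat \<times> comparison \<times> nat) list"

definition satisfies :: "constraints \<Rightarrow> nat list \<Rightarrow> bool" where
  "satisfies C xs \<longleftrightarrow> list_all (\<lambda>(p, r, q). holds r (xs ! p) (xs ! q)) C"

definition indices_below :: "nat \<Rightarrow> constraints \<Rightarrow> bool" where
  "indices_below n C \<longleftrightarrow> list_all (\<lambda>(p, r, q). p < n \<and> q < n) C"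

definition fillings :: "nat \<Rightarrow> constraints \<Rightarrow> nat multiset \<Rightarrow> nat list set" where
  "fillings n C M = {xs. length xs = n \<and> mset xs = M \<and> satisfies C xs}"

text \<open>Lists in \<open>fillings\<close> may contain 0, while variables are numbered from 1. The
  case distinction makes the series vanish where the series of the problem do.\<close>

definition filling_series :: "nat \<Rightarrow> constraints \<Rightarrow> series" where
  "filling_series n C M = (if 0 \<in># M then 0 else of_nat (card (fillings n C M)))"

lemma finite_fillings: "finite (fillings n C M)"
proof (rule finite_subset)
  show "fillings n C M \<subseteq> {xs. set xs \<subseteq> set_mset M \<and> length xs = n}"
    by (auto simp: fillings_def)
qed (simp add: finite_lists_length_eq)

lemma satisfies_map:
  assumes "indices_below (length cs) C"
  shows "satisfies C (map f cs) \<longleftrightarrow> (\<forall>(p, r, q) \<in> set C. holds r (f (cs ! p)) (f (cs ! q)))"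
  unfolding satisfies_def list_all_iff
proof (rule ball_cong[OF refl])
  fix x assume "x \<in> set C"
  with assms show "(case x of (p, r, q) \<Rightarrow> holds r (map f cs ! p) (map f cs ! q)) \<longleftrightarrow>
      (case x of (p, r, q) \<Rightarrow> holds r (f (cs ! p)) (f (cs ! q)))"
    by (cases x) (auto simp: indices_below_def list_all_iff)
qed

text \<open>Functions on a finite set are read off as the list of their values along an enumeration.\<close>

lemma filling_series_eq_card:
  assumes "distinct cs" "set cs = D"
    and "\<And>f. f \<in> D \<rightarrow>\<^sub>E {1..} \<Longrightarrow> f \<in> F \<longleftrightarrow> satisfies C (map f cs)"
    and "F \<subseteq> D \<rightarrow>\<^sub>E {1..}"
  shows "of_nat (card {f \<in> F. image_mset f (mset_set D) = M}) = filling_series (length cs) C M"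
proof -
  have image: "image_mset f (mset_set D) = mset (map f cs)" for f :: "'a \<Rightarrow> nat"
    using assms(1,2) mset_set_set by fastforce
  show ?thesis
  proof (cases "0 \<in># M")
    case True
    have "{f \<in> F. image_mset f (mset_set D) = M} = {}"
    proof (rule ccontr)
      assume "{f \<in> F. image_mset f (mset_set D) = M} \<noteq> {}"
      then obtain f where "f \<in> F" "mset (map f cs) = M"
        by (auto simp: image)
      with True obtain d where "d \<in> D" "f d = 0"
        using assms(2) by auto
      with \<open>f \<in> F\<close> assms(4) show False
        by (force dest: PiE_mem)
    qed
    with True show ?thesis by (simp only: filling_series_def card.empty of_nat_0 if_True)
  next
    case False
    have "bij_betw (\<lambda>f. map f cs) {f \<in> F. image_mset f (mset_set D) = M} (fillings (length cs) C M)"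
    \<comment> \<open>The inverse looks up an element's position in the enumeration
      \<open>cs\<close>; restricting to \<open>D\<close> restores extensionality.\<close>
    proof (rule bij_betw_byWitness[where f' = "\<lambda>xs. restrict (\<lambda>d. the (map_of (zip cs xs) d)) D"])
      have map_eq: "map (restrict (\<lambda>d. the (map_of (zip cs xs) d)) D) cs = xs"
        if "length xs = length cs" for xs :: "nat list"
        using that assms(1,2) by (intro nth_equalityI) (auto simp: map_of_zip_nth)
      show "\<forall>f\<in>{f \<in> F. image_mset f (mset_set D) = M}.
          restrict (\<lambda>d. the (map_of (zip cs (map f cs)) d)) D = f"
        using assms(2,4) by (auto simp: map_of_zip_map fun_eq_iff PiE_def extensional_def)
      show "\<forall>xs\<in>fillings (length cs) C M. map (restrict (\<lambda>d. the (map_of (zip cs xs) d)) D) cs = xs"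
        using map_eq by (auto simp: fillings_def)
      show "(\<lambda>f. map f cs) ` {f \<in> F. image_mset f (mset_set D) = M} \<subseteq> fillings (length cs) C M"
        using assms(3,4) by (auto simp: fillings_def image simp del: mset_map)
      show "(\<lambda>xs. restrict (\<lambda>d. the (map_of (zip cs xs) d)) D) ` fillings (length cs) C M
          \<subseteq> {f \<in> F. image_mset f (mset_set D) = M}"
      proof (rule image_subsetI)
        fix xs assume xs: "xs \<in> fillings (length cs) C M"
        let ?f = "restrict (\<lambda>d. the (map_of (zip cs xs) d)) D"
        have eq: "map ?f cs = xs"
          using xs map_eq by (simp add: fillings_def)
        have "?f d \<in> set (map ?f cs)" if "d \<in> D" for d
          unfolding set_map assms(2) using that by (rule imageI)
        then have "?f d \<in> set xs" if "d \<in> D" for d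
          using that by (simp only: eq)
        then have "?f d \<ge> 1" if "d \<in> D" for d
          using that xs False unfolding fillings_def
          by (metis (mono_tags, lifting) One_nat_def Suc_leI gr0I mem_Collect_eq set_mset_mset)
        then have "?f \<in> D \<rightarrow>\<^sub>E {1..}" by auto
        then show "?f \<in> {f \<in> F. image_mset f (mset_set D) = M}"
          using xs assms(3) by (simp add: image eq fillings_def del: mset_map)
      qed
    qed
    with False show ?thesis
      by (simp add: filling_series_def bij_betw_same_card)
  qed
qed

section \<open>The series of the problem as filling series\<close>

definition graph_of :: "nat \<Rightarrow> (nat \<times> nat) list \<Rightarrow> nat pair_pre_digraph" where
  "graph_of n es = \<lparr>pverts = {..<n}, parcs = set es \<union> (set es)\<inverse>\<rparr>"

definition edge_constraints :: "(nat \<times> nat) list \<Rightarrow> constraints" where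
  "edge_constraints es = map (\<lambda>(u, v). (u, Ne, v)) es"

text \<open>The vertices are enumerated in their natural order. One constraint per listed edge
  suffices for both arcs because \<open>Ne\<close> is symmetric.\<close>

lemma chromatic_sym_graph_of:
  assumes "indices_below n (edge_constraints es)"
  shows "chromatic_sym (graph_of n es) = filling_series n (edge_constraints es)"
proof
  fix M
  have "of_nat (card {\<kappa> \<in> proper_colorings (graph_of n es). image_mset \<kappa> (mset_set {..<n}) = M})
      = filling_series (length [0..<n]) (edge_constraints es) M"
  proof (rule filling_series_eq_card)
    fix \<kappa> :: "nat \<Rightarrow> nat" assume "\<kappa> \<in> {..<n} \<rightarrow>\<^sub>E {1..}"
    moreover have "satisfies (edge_constraints es) (map \<kappa> [0..<n]) \<longleftrightarrow> (\<forall>(u, v) \<in> set es. \<kappa> u \<noteq> \<kappa> v)"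
      using assms by (fastforce simp: satisfies_def edge_constraints_def indices_below_def list_all_iff)
    ultimately show "\<kappa> \<in> proper_colorings (graph_of n es) \<longleftrightarrow>
        satisfies (edge_constraints es) (map \<kappa> [0..<n])"
      by (fastforce simp: proper_colorings_def graph_of_def)
  qed (auto simp: proper_colorings_def graph_of_def)
  then show "chromatic_sym (graph_of n es) M = filling_series n (edge_constraints es) M"
    by (simp add: chromatic_sym_def graph_of_def)
qed

section \<open>Schur functions as filling series\<close>

definition cells :: "nat list \<Rightarrow> (nat \<times> nat) list" where
  "cells \<mu> = concat (map (\<lambda>i. map (Pair i) [0..<\<mu> ! i]) [0..<length \<mu>])"

text \<open>As in \<open>ssyt\<close>, any two cells of a common row or column are compared, not
  only neighbours. Positions refer to the row by row reading order of \<open>cells\<close>.\<close>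

definition tableau_constraints :: "nat list \<Rightarrow> constraints" where
  "tableau_constraints \<mu> = (let cs = cells \<mu>; n = length cs; ps = List.product [0..<n] [0..<n] in
     map (\<lambda>(p, q). (p, Le, q)) (filter (\<lambda>(p, q). fst (cs ! p) = fst (cs ! q) \<and> snd (cs ! p) < snd (cs ! q)) ps) @
     map (\<lambda>(p, q). (p, Lt, q)) (filter (\<lambda>(p, q). snd (cs ! p) = snd (cs ! q) \<and> fst (cs ! p) < fst (cs ! q)) ps))"

lemma length_cells: "length (cells \<mu>) = sum_list \<mu>"
  by (simp add: cells_def length_concat comp_def map_nth)

lemma set_cells: "set (cells \<mu>) = diagram \<mu>"
  by (auto simp: cells_def diagram_def)

lemma distinct_cells: "distinct (cells \<mu>)"
proof -
  have "card (set (cells \<mu>)) = length (cells \<mu>)"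
  proof -
    have "diagram \<mu> = (SIGMA i:{..<length \<mu>}. {..<\<mu> ! i})"
      by (auto simp: diagram_def)
    then show ?thesis
      unfolding set_cells length_cells by (simp add: sum_list_sum_nth atLeast0LessThan)
  qed
  then show ?thesis
    by (rule card_distinct)
qed

lemma indices_below_tableau_constraints: "indices_below (sum_list \<mu>) (tableau_constraints \<mu>)"
  unfolding length_cells[symmetric]
  by (auto simp: indices_below_def tableau_constraints_def Let_def list_all_iff)

lemma satisfies_tableau_constraints:
  "satisfies (tableau_constraints \<mu>) (map T (cells \<mu>)) \<longleftrightarrow>
     (\<forall>(i, j) \<in> diagram \<mu>. \<forall>(i', j') \<in> diagram \<mu>.
        (i = i' \<and> j < j' \<longrightarrow> T (i, j) \<le> T (i', j')) \<and> (j = j' \<and> i < i' \<longrightarrow> T (i, j) < T (i', j')))"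
  (is "?L \<longleftrightarrow> ?R")
proof -
  let ?cs = "cells \<mu>"
  have "?L \<longleftrightarrow> (\<forall>p<length ?cs. \<forall>q<length ?cs.
      (fst (?cs ! p) = fst (?cs ! q) \<and> snd (?cs ! p) < snd (?cs ! q) \<longrightarrow> T (?cs ! p) \<le> T (?cs ! q)) \<and>
      (snd (?cs ! p) = snd (?cs ! q) \<and> fst (?cs ! p) < fst (?cs ! q) \<longrightarrow> T (?cs ! p) < T (?cs ! q)))"
    by (subst satisfies_map[OF indices_below_tableau_constraints[of \<mu>, folded length_cells]])
      (auto simp: tableau_constraints_def Let_def ball_Un)
  also have "\<dots> \<longleftrightarrow> (\<forall>c\<in>set ?cs. \<forall>d\<in>set ?cs.
      (fst c = fst d \<and> snd c < snd d \<longrightarrow> T c \<le> T d) \<and> (snd c = snd d \<and> fst c < fst d \<longrightarrow> T c < T d))"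
    by (simp only: all_set_conv_all_nth)
  also have "\<dots> \<longleftrightarrow> ?R"
    unfolding set_cells by fastforce
  finally show ?thesis .
qed

text \<open>\<open>ssyt\<close> asks only that the larger cell of a comparison lie in the diagram.
  For a partition the other cell lies there too, so comparing cells of the diagram amounts to the
  same.\<close>

lemma schur_eq_filling_series:
  assumes "is_partition \<mu>"
  shows "schur \<mu> = filling_series (sum_list \<mu>) (tableau_constraints \<mu>)"
proof
  fix M
  have left: "(i, j) \<in> diagram \<mu>" if "(i, j') \<in> diagram \<mu>" "j < j'" for i j j'
    using that by (simp add: diagram_def)
  have "of_nat (card {T \<in> ssyt \<mu>. image_mset T (mset_set (diagram \<mu>)) = M})
      = filling_series (length (cells \<mu>)) (tableau_constraints \<mu>) M"
  proof (rule filling_series_eq_card[OF distinct_cells set_cells])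
    fix T assume "T \<in> diagram \<mu> \<rightarrow>\<^sub>E {1::nat..}"
    then show "T \<in> ssyt \<mu> \<longleftrightarrow> satisfies (tableau_constraints \<mu>) (map T (cells \<mu>))"
      unfolding satisfies_tableau_constraints ssyt_def
      using left diagram_up[OF assms] by blast
  qed (auto simp: ssyt_def)
  then show "schur \<mu> M = filling_series (sum_list \<mu>) (tableau_constraints \<mu>) M"
    by (simp add: schur_def length_cells)
qed

section \<open>Products and elementary symmetric functions as filling series\<close>

definition shift :: "nat \<Rightarrow> constraints \<Rightarrow> constraints" where
  "shift m C = map (\<lambda>(p, r, q). (m + p, r, m + q)) C"

lemma satisfies_append:
  assumes "indices_below (length xs) C" "indices_below (length ys) D"
  shows "satisfies (C @ shift (length xs) D) (xs @ ys) \<longleftrightarrow> satisfies C xs \<and> satisfies D ys"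
proof -
  have "satisfies C (xs @ ys) \<longleftrightarrow> satisfies C xs"
    using assms(1) unfolding satisfies_def indices_below_def list_all_iff
    by (intro ball_cong) (auto simp: nth_append)
  moreover have "satisfies (shift (length xs) D) (xs @ ys) \<longleftrightarrow> satisfies D ys"
    unfolding satisfies_def shift_def list_all_iff by (auto simp: nth_append)
  ultimately show ?thesis
    by (simp add: satisfies_def)
qed

lemma indices_below_append:
  assumes "indices_below m C" "indices_below n D"
  shows "indices_below (m + n) (C @ shift m D)"
proof -
  have "indices_below (m + n) C"
    using assms(1) unfolding indices_below_def by (rule list.pred_mono_strong) auto
  moreover have "indices_below (m + n) (shift m D)"
    using assms(2) unfolding indices_below_def shift_def list.pred_map
    by (rule list.pred_mono_strong) auto
  ultimately show ?thesis
    by (simp add: indices_below_def)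
qed

text \<open>A list of length \<open>m + n\<close> is cut uniquely after \<open>m\<close> entries,
  and the multiset of the first piece is the index \<open>A\<close> of the product. No constraint
  links the two pieces, so their counts multiply.\<close>

lemma series_mult_filling_series:
  assumes "indices_below m C" "indices_below n D"
  shows "series_mult (filling_series m C) (filling_series n D) = filling_series (m + n) (C @ shift m D)"
proof
  fix M
  show "series_mult (filling_series m C) (filling_series n D) M = filling_series (m + n) (C @ shift m D) M"
  proof (cases "0 \<in># M")
    case True
    \<comment> \<open>An index 0 of \<open>M\<close> falls to one of the two factors, which vanishes
      there.\<close>
    have "filling_series m C A * filling_series n D (M - A) = 0" if "A \<subseteq># M" for A
    proof -
      have "M = A + (M - A)" using that by simp
      then have "0 \<in># A \<or> 0 \<in># M - A" using True by (metis union_iff)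
      then show ?thesis by (auto simp: filling_series_def)
    qed
    then have "series_mult (filling_series m C) (filling_series n D) M = 0"
      unfolding series_mult_def by (intro sum.neutral) blast
    with True show ?thesis
      by (simp add: filling_series_def)
  next
    case False
    let ?S = "SIGMA A:{A. A \<subseteq># M}. fillings m C A \<times> fillings n D (M - A)"
    have "filling_series m C A * filling_series n D (M - A)
        = of_nat (card (fillings m C A \<times> fillings n D (M - A)))" if "A \<subseteq># M" for A
      using that False by (auto simp: filling_series_def card_cartesian_product dest: in_diffD mset_subset_eqD)
    then have "series_mult (filling_series m C) (filling_series n D) M
        = of_nat (\<Sum>A | A \<subseteq># M. card (fillings m C A \<times> fillings n D (M - A)))"
      by (simp add: series_mult_def)
    also have "\<dots> = of_nat (card ?S)"
      by (simp add: finite_submultisets finite_fillings)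
    also have "card ?S = card (fillings (m + n) (C @ shift m D) M)"
    proof (rule bij_betw_same_card, rule bij_betw_byWitness)
      show "\<forall>t\<in>?S. (\<lambda>zs. (mset (take m zs), take m zs, drop m zs)) ((\<lambda>(A, xs, ys). xs @ ys) t) = t"
        by (auto simp: fillings_def)
      show "\<forall>zs\<in>fillings (m + n) (C @ shift m D) M.
          (\<lambda>(A, xs, ys). xs @ ys) (mset (take m zs), take m zs, drop m zs) = zs"
        by simp
      show "(\<lambda>(A, xs, ys). xs @ ys) ` ?S \<subseteq> fillings (m + n) (C @ shift m D) M"
        using assms satisfies_append by (fastforce simp: fillings_def)
      show "(\<lambda>zs. (mset (take m zs), take m zs, drop m zs)) ` fillings (m + n) (C @ shift m D) M \<subseteq> ?S"
      proof (rule image_subsetI)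
        fix zs assume "zs \<in> fillings (m + n) (C @ shift m D) M"
        then have zs: "length zs = m + n" "mset zs = M" "satisfies (C @ shift m D) zs"
          by (auto simp: fillings_def)
        have M: "M = mset (take m zs) + mset (drop m zs)"
          using zs(2) by (metis append_take_drop_id mset_append)
        have "satisfies C (take m zs) \<and> satisfies D (drop m zs)"
          using satisfies_append[of "take m zs" C "drop m zs" D] zs assms by simp
        then show "(mset (take m zs), take m zs, drop m zs) \<in> ?S"
          using zs(1) by (simp add: fillings_def M)
      qed
    qed
    finally show ?thesis
      using False by (simp add: filling_series_def[of "m + n"])
  qed
qed

text \<open>Comparing consecutive entries suffices by transitivity. For \<open>k = 0\<close> the
  truncated subtraction yields no constraint.\<close>

definition increasing_constraints :: "nat \<Rightarrow> constraints" where
  "increasing_constraints k = map (\<lambda>p. (p, Lt, Suc p)) [0..<k - 1]"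

lemma satisfies_increasing_constraints:
  "satisfies (increasing_constraints (length xs)) xs \<longleftrightarrow> sorted_wrt (<) xs"
  by (auto simp: satisfies_def increasing_constraints_def list_all_iff sorted_wrt_iff_nth_Suc_transp)

lemma indices_below_increasing_constraints: "indices_below k (increasing_constraints k)"
  by (auto simp: indices_below_def increasing_constraints_def list_all_iff)

text \<open>A multiset has a strictly increasing arrangement exactly if it has no repeated element,
  and then only one, the sorted list.\<close>

lemma elem_eq_filling_series: "elem k = filling_series k (increasing_constraints k)"
proof
  fix M
  show "elem k M = filling_series k (increasing_constraints k) M"
  proof (cases "\<exists>S. S \<subseteq> {1..} \<and> finite S \<and> card S = k \<and> M = mset_set S")
    case True
    then obtain S where S: "S \<subseteq> {1..}" "finite S" "card S = k" "M = mset_set S"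
      by blast
    have "fillings k (increasing_constraints k) M = {sorted_list_of_set S}"
    proof (intro equalityI subsetI)
      fix xs assume "xs \<in> fillings k (increasing_constraints k) M"
      then have "sorted_wrt (<) xs" "mset xs = mset_set S"
        using S(4) satisfies_increasing_constraints by (auto simp: fillings_def)
      then show "xs \<in> {sorted_list_of_set S}"
        using S(2) by (metis finite_set_mset_mset_set set_mset_mset singletonI sorted_list_of_set.idem_if_sorted_distinct
            strict_sorted_iff)
    next
      fix xs assume "xs \<in> {sorted_list_of_set S}"
      then show "xs \<in> fillings k (increasing_constraints k) M"
        using S satisfies_increasing_constraints[of xs] mset_set_set[of xs] by (simp add: fillings_def)
    qed
    moreover have "0 \<notin># M"
      using S by auto
    ultimately show ?thesis
      using True by (simp add: elem_def filling_series_def)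
  next
    case False
    have "fillings k (increasing_constraints k) M = {}" if "0 \<notin># M"
    proof (rule ccontr)
      assume "fillings k (increasing_constraints k) M \<noteq> {}"
      then obtain xs where xs: "length xs = k" "mset xs = M" "sorted_wrt (<) xs"
        using satisfies_increasing_constraints by (auto simp: fillings_def)
      then have "distinct xs" by (simp add: strict_sorted_iff)
      moreover have "set xs \<subseteq> {1..}"
        using that xs(2) by (metis atLeast_iff less_one linorder_le_less_linear set_mset_mset subsetI)
      ultimately show False
        using False xs by (metis distinct_card List.finite_set mset_set_set)
    qed
    with False show ?thesis
      by (simp add: elem_def filling_series_def)
  qed
qed

text \<open>One strictly increasing block per factor of the product, with no condition between the
  blocks.\<close>

fun column_constraints :: "nat list \<Rightarrow> constraints" where
  "column_constraints [] = []"
| "column_constraints (k # \<mu>) = increasing_constraints k @ shift k (column_constraints \<mu>)"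

lemma indices_below_column_constraints: "indices_below (sum_list \<mu>) (column_constraints \<mu>)"
proof (induction \<mu>)
  case (Cons k \<mu>)
  then show ?case
    using indices_below_append[OF indices_below_increasing_constraints] by simp
qed (simp add: indices_below_def)

lemma elem_sym_eq_filling_series: "elem_sym \<mu> = filling_series (sum_list \<mu>) (column_constraints \<mu>)"
proof (induction \<mu>)
  case Nil
  show ?case
    by (auto simp: fun_eq_iff elem_sym_Nil series_one_def filling_series_def fillings_def satisfies_def)
next
  case (Cons k \<mu>)
  then show ?case
    by (simp add: elem_sym_Cons elem_eq_filling_series series_mult_filling_series
        indices_below_column_constraints indices_below_increasing_constraints)
qed

section \<open>Reduction to packed monomials\<close>

lemma satisfies_strict_mono:
  assumes "strict_mono_on (set xs) \<phi>" "indices_below (length xs) C"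
  shows "satisfies C (map \<phi> xs) \<longleftrightarrow> satisfies C xs"
proof -
  have "holds r (\<phi> x) (\<phi> y) \<longleftrightarrow> holds r x y" if "x \<in> set xs" "y \<in> set xs" for r x y
    using that assms(1)
    by (cases r) (simp_all add: strict_mono_on_less strict_mono_on_less_eq strict_mono_on_eq)
  then show ?thesis
    unfolding satisfies_map[OF assms(2)] using assms(2)
    by (fastforce simp: satisfies_def indices_below_def list_all_iff)
qed

text \<open>Applying \<open>\<phi>\<close> entrywise is a bijection of fillings, since a strictly
  monotone relabelling preserves and reflects all three comparisons. The inverse is taken on the
  elements of \<open>M\<close> only, where \<open>\<phi>\<close> is injective.\<close>

lemma card_fillings_strict_mono:
  assumes "strict_mono_on (set_mset M) \<phi>" "indices_below n C"
  shows "card (fillings n C (image_mset \<phi> M)) = card (fillings n C M)"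
proof -
  have inj: "inj_on \<phi> (set_mset M)"
    using assms(1) by (rule strict_mono_on_imp_inj_on)
  let ?\<psi> = "inv_into (set_mset M) \<phi>"
  have inv: "image_mset (?\<psi> \<circ> \<phi>) M = M"
    using inj by (intro multiset.map_ident_strong) simp
  have "bij_betw (map \<phi>) (fillings n C M) (fillings n C (image_mset \<phi> M))"
  proof (rule bij_betw_byWitness[where f' = "map ?\<psi>"])
    show "\<forall>xs\<in>fillings n C M. map ?\<psi> (map \<phi> xs) = xs"
      using inj by (auto simp: fillings_def intro!: map_idI)
    show ret: "\<forall>ys\<in>fillings n C (image_mset \<phi> M). map \<phi> (map ?\<psi> ys) = ys"
    proof
      fix ys assume "ys \<in> fillings n C (image_mset \<phi> M)"
      then have "set ys = \<phi> ` set_mset M"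
        by (simp add: fillings_def flip: set_mset_mset)
      then show "map \<phi> (map ?\<psi> ys) = ys"
        unfolding map_map by (intro map_idI) (simp add: f_inv_into_f)
    qed
    show "map \<phi> ` fillings n C M \<subseteq> fillings n C (image_mset \<phi> M)"
      using satisfies_strict_mono assms by (auto simp: fillings_def)
    show "map ?\<psi> ` fillings n C (image_mset \<phi> M) \<subseteq> fillings n C M"
    proof (rule image_subsetI)
      fix ys assume ys: "ys \<in> fillings n C (image_mset \<phi> M)"
      have "mset (map ?\<psi> ys) = M"
        using ys inv by (simp add: fillings_def multiset.map_comp)
      moreover from this have "satisfies C (map ?\<psi> ys) \<longleftrightarrow> satisfies C (map \<phi> (map ?\<psi> ys))"
        using ys assms by (intro satisfies_strict_mono[symmetric])
          (auto simp: fillings_def simp flip: set_mset_mset)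
      ultimately show "map ?\<psi> ys \<in> fillings n C M"
        using ys ret by (simp add: fillings_def)
    qed
  qed
  then show ?thesis
    by (simp add: bij_betw_same_card)
qed

text \<open>The sorted lists of length \<open>n\<close> whose entries are exactly $0, \dots, m$ for some $m$, one for
  each of the $2^{n-1}$ compositions of $n$. The entry 0 does no harm, as only \<open>filling_series\<close>
  singles it out.\<close>

fun packed :: "nat \<Rightarrow> nat list list" where
  "packed 0 = [[]]"
| "packed (Suc 0) = [[0]]"
| "packed (Suc n) = concat (map (\<lambda>zs. [0 # zs, 0 # map Suc zs]) (packed n))"

text \<open>Induction from the front: a first entry equal to the next one repeats the leading 0, a
  smaller one takes 0 and moves the other entries up by \<open>Suc\<close>. The clause on
  \<open>hd\<close> carries the induction, as it ties 0 to the first entry.\<close>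

lemma exists_packed:
  assumes "sorted ys"
  shows "\<exists>zs \<in> set (packed (length ys)). length zs = length ys \<and> (zs \<noteq> [] \<longrightarrow> hd zs = 0) \<and>
    (\<exists>\<phi>. strict_mono_on (set zs) \<phi> \<and> ys = map \<phi> zs)"
  using assms
proof (induction ys rule: induct_list012)
  case 1
  then show ?case by simp
next
  case (2 y)
  then show ?case
    \<comment> \<open>On the singleton of 0 every function is strictly monotone, so a constant will
      do.\<close>
    by (auto intro!: exI[of _ "\<lambda>_. y"] simp: strict_mono_on_def)
next
  case (3 y y' ys)
  from "3.prems" have "sorted (y' # ys)" by simp
  from "3.IH"(2)[OF this] obtain zs \<phi> where zs: "zs \<in> set (packed (length (y' # ys)))" "length zs = length (y' # ys)"
      "zs \<noteq> [] \<longrightarrow> hd zs = 0" "strict_mono_on (set zs) \<phi>" "y' # ys = map \<phi> zs"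
    by (elim bexE conjE exE) (rule that)
  then obtain zs' where zs': "zs = 0 # zs'" "\<phi> 0 = y'"
    by (cases zs) auto
  show ?case
  proof (cases "y = y'")
    case True
    then show ?thesis
      using zs zs' by (intro bexI[of _ "0 # zs"]) (auto intro!: exI[of _ \<phi>])
  next
    case False
    then have "y < y'" using "3.prems" by (simp add: less_le)
    then have less: "y < \<phi> z" if "z \<in> set zs" for z
      using that zs(5) "3.prems" by (metis (no_types, lifting) image_eqI less_le_trans list.set_map order_refl set_ConsD sorted_simps(2))
    \<comment> \<open>The new 0 is sent to \<open>y\<close>, and \<open>Suc z\<close> to the former
      value at \<open>z\<close>.\<close>
    define \<psi> where "\<psi> = case_nat y \<phi>"
    have mono: "strict_mono_on (set (0 # map Suc zs)) \<psi>"
      using zs(4) less by (auto simp: strict_mono_on_def \<psi>_def)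
    have eq: "y # y' # ys = map \<psi> (0 # map Suc zs)"
      using zs(5) by (simp add: \<psi>_def)
    have mem: "0 # map Suc zs \<in> set (packed (length (y # y' # ys)))"
      using zs(1) by auto
    show ?thesis
      by (intro bexI[OF _ mem] conjI exI[of _ \<psi>] mono eq) (use zs(2) in simp_all)
  qed
qed

section \<open>Counting fillings by enumeration\<close>

primrec arrangements :: "nat \<Rightarrow> 'a list \<Rightarrow> 'a list list" where
  "arrangements 0 xs = [[]]"
| "arrangements (Suc n) xs =
     concat (map (\<lambda>x. map ((#) x) (arrangements n (remove1 x xs))) (remdups xs))"

lemma set_arrangements: "length xs = n \<Longrightarrow> set (arrangements n xs) = {ys. mset ys = mset xs}"
proof (induction n arbitrary: xs)
  case (Suc n)
  have "set (arrangements n (remove1 x xs)) = {ys. mset ys = mset xs - {#x#}}" if "x \<in> set xs" for x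
    using that Suc by (simp add: length_remove1)
  then have "set (arrangements (Suc n) xs) = (\<Union>x\<in>set xs. (#) x ` {ys. mset ys = mset xs - {#x#}})"
    by auto
  also have "\<dots> = {ys. mset ys = mset xs}"
  proof (intro equalityI subsetI)
    fix ys assume "ys \<in> {ys. mset ys = mset xs}"
    then have eq: "mset ys = mset xs" by simp
    then obtain y ys' where ys: "ys = y # ys'"
      using Suc.prems by (cases ys) auto
    then have "y \<in> set xs" "mset ys' = mset xs - {#y#}"
      using eq by (metis list.set_intros(1) set_mset_mset) (simp flip: eq add: ys)
    then show "ys \<in> (\<Union>x\<in>set xs. (#) x ` {ys. mset ys = mset xs - {#x#}})"
      using ys by blast
  qed auto
  finally show ?case .
qed simp

text \<open>Arrangements with different first entries differ, and \<open>remdups\<close> offers each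
  first entry once. Thus the length of the filtered list is a cardinality.\<close>

lemma distinct_arrangements: "distinct (arrangements n xs)"
proof (induction n arbitrary: xs)
  case (Suc n)
  have "distinct (concat (map (\<lambda>x. map ((#) x) (arrangements n (remove1 x xs))) zs))"
    if "distinct zs" for zs
    using that Suc.IH by (induction zs) (auto simp: distinct_map)
  then show ?case by simp
qed simp

definition count_fillings :: "constraints \<Rightarrow> nat list \<Rightarrow> int" where
  "count_fillings C zs = int (length (filter (satisfies C) (arrangements (length zs) zs)))"

lemma card_fillings_eq_count: "int (card (fillings (length zs) C (mset zs))) = count_fillings C zs"
proof -
  have "fillings (length zs) C (mset zs) = set (filter (satisfies C) (arrangements (length zs) zs))"
    by (auto simp: fillings_def set_arrangements dest: mset_eq_length)
  then show ?thesis
    by (simp only: count_fillings_def distinct_card[OF distinct_filter[OF distinct_arrangements]])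
qed

text \<open>The same \<open>zs\<close> works for every \<open>C\<close>, so a linear relation
  between counts at \<open>zs\<close> carries over to the series at \<open>M\<close>.\<close>

lemma filling_series_packed:
  assumes "0 \<notin># M" "size M = n"
  obtains zs where "zs \<in> set (packed n)"
    "\<And>C. indices_below n C \<Longrightarrow> filling_series n C M = of_int (count_fillings C zs)"
proof -
  define ys where "ys = sorted_list_of_multiset M"
  have ys: "mset ys = M" "sorted ys" "length ys = n"
    using assms(2) by (auto simp: ys_def simp flip: size_mset)
  obtain zs \<phi> where zs: "zs \<in> set (packed n)" "length zs = n" "strict_mono_on (set zs) \<phi>" "ys = map \<phi> zs"
    using exists_packed[OF ys(2)] ys(3) by auto
  have M: "M = image_mset \<phi> (mset zs)"
    using ys(1) zs(4) by simp
  have "filling_series n C M = of_int (count_fillings C zs)" if "indices_below n C" for C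
  proof -
    have "card (fillings n C M) = card (fillings n C (mset zs))"
      unfolding M using zs(3) that by (intro card_fillings_strict_mono) auto
    then show ?thesis
      using assms(1) zs(2) card_fillings_eq_count[of zs C]
      by (metis filling_series_def of_int_of_nat_eq)
  qed
  with zs(1) show thesis
    by (rule that)
qed

lemma filling_series_size: "size M \<noteq> n \<Longrightarrow> filling_series n C M = 0"
proof -
  assume "size M \<noteq> n"
  then have "fillings n C M = {}"
    by (auto simp: fillings_def)
  then show ?thesis by (simp add: filling_series_def)
qed

section \<open>Certificates for expansions\<close>

definition coeffs :: "(nat list \<times> int) list \<Rightarrow> nat list \<Rightarrow> rat" where
  "coeffs L \<mu> = (case map_of L \<mu> of None \<Rightarrow> 0 | Some a \<Rightarrow> of_int a)"

text \<open>An executable certificate: \<open>K\<close> gives the constraints of the basis elements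
  and \<open>L\<close> the claimed coefficients. The comparison involves integers and finitely many
  lists only.\<close>

definition expands :: "(nat list \<Rightarrow> constraints) \<Rightarrow> nat \<Rightarrow> constraints \<Rightarrow> (nat list \<times> int) list \<Rightarrow> bool" where
  "expands K n C L \<longleftrightarrow> indices_below n C \<and> distinct (map fst L) \<and>
     list_all (\<lambda>(\<mu>, a). is_partition \<mu> \<and> sum_list \<mu> = n) L \<and>
     list_all (\<lambda>zs. sum_list (map (\<lambda>(\<mu>, a). a * count_fillings (K \<mu>) zs) L) = count_fillings C zs) (packed n)"

text \<open>Both sides vanish on multisets that contain 0 or have a size other than
  \<open>n\<close>. Any other multiset has the same counts as some packed list, where the
  certificate applies.\<close>

lemma expansion_of_expands:
  assumes "expands K n C L"
    and b: "\<And>\<mu>. is_partition \<mu> \<Longrightarrow> b \<mu> = filling_series (sum_list \<mu>) (K \<mu>)"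
    and K: "\<And>\<mu>. indices_below (sum_list \<mu>) (K \<mu>)"
  shows "expansion b (filling_series n C) (coeffs L)"
proof -
  have C: "indices_below n C" and dist: "distinct (map fst L)"
    and part: "\<And>\<mu> a. (\<mu>, a) \<in> set L \<Longrightarrow> is_partition \<mu> \<and> sum_list \<mu> = n"
    and packed: "\<And>zs. zs \<in> set (packed n) \<Longrightarrow>
      sum_list (map (\<lambda>(\<mu>, a). a * count_fillings (K \<mu>) zs) L) = count_fillings C zs"
    using assms(1) unfolding expands_def list_all_iff by fast+
  have "filling_series n C M = (\<Sum>(\<mu>, a)\<leftarrow>L. of_int a * b \<mu> M)" for M
  proof (cases "0 \<notin># M \<and> size M = n")
    case True
    then obtain zs where zs: "zs \<in> set (packed n)"
      "\<And>C. indices_below n C \<Longrightarrow> filling_series n C M = of_int (count_fillings C zs)"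
      using filling_series_packed by metis
    have "b \<mu> M = of_int (count_fillings (K \<mu>) zs)" if "(\<mu>, a) \<in> set L" for \<mu> a
      using part[OF that] b K zs(2) by metis
    then have "(\<Sum>(\<mu>, a)\<leftarrow>L. of_int a * b \<mu> M) = (\<Sum>(\<mu>, a)\<leftarrow>L. of_int (a * count_fillings (K \<mu>) zs))"
      by (intro arg_cong[of _ _ sum_list] map_cong) auto
    also have "\<dots> = of_int (\<Sum>(\<mu>, a)\<leftarrow>L. a * count_fillings (K \<mu>) zs)"
      by (induction L) auto
    also have "\<dots> = filling_series n C M"
      using packed[OF zs(1)] zs(2)[OF C] by simp
    finally show ?thesis by simp
  next
    case False
    then have vanish: "filling_series n D M = 0" for D
      by (auto simp: filling_series_size) (simp add: filling_series_def)
    then have "b \<mu> M = 0" if "(\<mu>, a) \<in> set L" for \<mu> a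
      using part[OF that] b by metis
    then have "(\<Sum>(\<mu>, a)\<leftarrow>L. of_int a * b \<mu> M) = (\<Sum>(\<mu>, a)\<leftarrow>L. 0)"
      by (intro arg_cong[of _ _ sum_list] map_cong) auto
    then show ?thesis by (simp add: vanish case_prod_unfold)
  qed
  also have "(\<Sum>(\<mu>, a)\<leftarrow>L. of_int a * b \<mu> M) = (\<Sum>\<mu>\<in>set (map fst L). coeffs L \<mu> * b \<mu> M)" for M
  proof -
    \<comment> \<open>Distinct keys ensure that \<open>map_of\<close> returns the coefficient of
      each entry, and they turn the list sum into a sum over a set.\<close>
    have "(\<Sum>(\<mu>, a)\<leftarrow>L. of_int a * b \<mu> M) = (\<Sum>\<mu>\<leftarrow>map fst L. coeffs L \<mu> * b \<mu> M)"
      using dist by (auto simp: coeffs_def comp_def intro!: arg_cong[of _ _ sum_list])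
    then show ?thesis
      using dist by (simp only: sum_list_distinct_conv_sum_set)
  qed
  finally show ?thesis
    by (rule expansion_superset[rotated 3])
      (use part in \<open>auto simp: coeffs_def split: option.splits dest!: map_of_SomeD intro: rev_image_eqI\<close>)
qed

lemmas expansion_elem_sym =
  expansion_of_expands[OF _ elem_sym_eq_filling_series indices_below_column_constraints]

lemmas expansion_schur =
  expansion_of_expands[OF _ schur_eq_filling_series indices_below_tableau_constraints]

section \<open>The four graphs\<close>

text \<open>The listed edges contain the path through all vertices in their natural order, so
  everything is reachable from 0.\<close>

lemma connected_graph_of:
  assumes n: "0 < n" and edges: "\<forall>(u, v) \<in> set es. u < n \<and> v < n \<and> u \<noteq> v"
    and path: "\<forall>i < n - 1. (i, Suc i) \<in> set es"
  shows "connected_graph_on n (graph_of n es)"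
proof -
  let ?G = "graph_of n es"
  interpret pair_graph ?G
  proof
    show "symmetric ?G"
      by (auto simp: graph_of_def symmetric_def sym_def)
  qed (use edges in \<open>auto simp: graph_of_def\<close>)
  let ?R = "rtrancl_on {..<n} ((set es \<union> (set es)\<inverse>)\<^sup>s)"
  have from_0: "(0, v) \<in> ?R" if "v < n" for v
    using that
  proof (induction v)
    case 0
    then show ?case by simp
  next
    case (Suc v)
    then have "(0, v) \<in> ?R" by simp
    moreover have "(v, Suc v) \<in> (set es \<union> (set es)\<inverse>)\<^sup>s"
      using path Suc.prems by (auto simp: symcl_def)
    ultimately show ?case
      using Suc.prems by (auto intro: rtrancl_on_into_rtrancl_on)
  qed
  have "sym ?R"
    by (rule rtrancl_on_sym) (auto simp: sym_def symcl_def)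
  then have "(u, v) \<in> ?R" if "u < n" "v < n" for u v
    using from_0[OF that(1)] from_0[OF that(2)] by (meson rtrancl_on_trans symD)
  then have "Digraph_Component.connected (with_proj ?G)"
    using n by (auto simp: connected_conv graph_of_def)
  then show ?thesis
    using pair_graph_axioms by (simp add: connected_graph_on_def graph_of_def)
qed

section \<open>The relations in terms of coefficients\<close>

lemma positive_in_diff_iff:
  assumes "triangular b" "expansion b F c" "expansion b G d"
  shows "positive_in b (\<lambda>M. F M - coefficient b \<rho> F / coefficient b \<rho> G * G M) \<longleftrightarrow>
    (\<forall>\<mu>. c \<mu> - c \<rho> / d \<rho> * d \<mu> \<ge> 0)"
  by (simp only: coefficient_eq[OF assms(1,2)] coefficient_eq[OF assms(1,3)]
      positive_in_iff[OF assms(1) expansion_diff[OF assms(2,3)]])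

text \<open>The arguments swap: \<open>G \<le>\<^sub>e H\<close> concerns \<open>X_e H G\<close>, so
  a multiple of the series of the smaller graph, with coefficients \<open>L\<close>, is subtracted
  from that of the larger one.\<close>

lemma le_e_graph_of_iff:
  assumes "expands column_constraints n (edge_constraints es) L"
    and "expands column_constraints n (edge_constraints es') L'"
  shows "graph_of n es \<le>\<^sub>e graph_of n es' \<longleftrightarrow>
    (\<forall>\<mu>. coeffs L' \<mu> - coeffs L' [n] / coeffs L [n] * coeffs L \<mu> \<ge> 0)"
proof -
  have "chromatic_sym (graph_of n es) = filling_series n (edge_constraints es)"
    "chromatic_sym (graph_of n es') = filling_series n (edge_constraints es')"
    using assms by (simp_all add: chromatic_sym_graph_of expands_def)
  moreover have "card (pverts (graph_of n es')) = n"
    by (simp add: graph_of_def)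
  ultimately show ?thesis
    using positive_in_diff_iff[OF triangular_elem_sym assms(2,1)[THEN expansion_elem_sym]]
    by (simp add: le_e_def X_e_def)
qed

lemma le_s_graph_of_iff:
  assumes "expands tableau_constraints n (edge_constraints es) L"
    and "expands tableau_constraints n (edge_constraints es') L'"
  shows "graph_of n es \<le>\<^sub>s graph_of n es' \<longleftrightarrow>
    (\<forall>\<mu>. coeffs L' \<mu> - coeffs L' (replicate n 1) / coeffs L (replicate n 1) * coeffs L \<mu> \<ge> 0)"
proof -
  have "chromatic_sym (graph_of n es) = filling_series n (edge_constraints es)"
    "chromatic_sym (graph_of n es') = filling_series n (edge_constraints es')"
    using assms by (simp_all add: chromatic_sym_graph_of expands_def)
  moreover have "card (pverts (graph_of n es')) = n"
    by (simp add: graph_of_def)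
  ultimately show ?thesis
    using positive_in_diff_iff[OF triangular_schur assms(2,1)[THEN expansion_schur]]
    by (simp add: le_s_def X_s_def)
qed

lemma chromatic_sym_graph_of_neq:
  assumes "expands column_constraints n (edge_constraints es) L"
    and "expands column_constraints n (edge_constraints es') L'"
    and "coeffs L \<mu> \<noteq> coeffs L' \<mu>"
  shows "chromatic_sym (graph_of n es) \<noteq> chromatic_sym (graph_of n es')"
proof -
  have "e_coeff \<mu> (chromatic_sym (graph_of n es)) = coeffs L \<mu>"
    "e_coeff \<mu> (chromatic_sym (graph_of n es')) = coeffs L' \<mu>"
    using assms(1,2)[THEN expansion_elem_sym, THEN coefficient_eq[OF triangular_elem_sym]] assms(1,2)
    by (simp_all add: chromatic_sym_graph_of expands_def)
  with assms(3) show ?thesis by auto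
qed

text \<open>Each list begins with the path that \<open>connected_graph_of\<close> asks for.
  \<open>diamond\<close> lacks only the edge between 1 and 3; \<open>house\<close> is the 4-cycle 0,
  2, 3, 4 with the triangle 0, 1, 2 as its roof; \<open>flag\<close> has the pendant vertex 0
  attached to 1.\<close>

definition "diamond = [(0, 1), (1, 2), (2, 3), (0, 2), (0, 3)]"
definition "square = [(0, 1), (1, 2), (2, 3), (0, 3)]"
definition "house = [(0, 1), (1, 2), (2, 3), (3, 4), (0, 2), (0, 4)]"
definition "flag = [(0, 1), (1, 2), (2, 3), (3, 4), (1, 3), (2, 4)]"

text \<open>The identities are evaluated at the 8 packed lists of length 4; the graphs on 5 vertices
  below need 16 lists.\<close>

lemma expands_diamond:
  "expands column_constraints 4 (edge_constraints diamond) [([4], 16), ([3, 1], 2)]"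
  "expands tableau_constraints 4 (edge_constraints diamond) [([2, 1, 1], 2), ([1, 1, 1, 1], 18)]"
  by code_simp+

lemma expands_square:
  "expands column_constraints 4 (edge_constraints square) [([4], 12), ([2, 2], 2)]"
  "expands tableau_constraints 4 (edge_constraints square)
     [([2, 2], 2), ([2, 1, 1], 2), ([1, 1, 1, 1], 14)]"
  by code_simp+
lemma expands_house:
  "expands column_constraints 5 (edge_constraints house) [([5], 30), ([4, 1], 6), ([3, 2], 6)]"
  "expands tableau_constraints 5 (edge_constraints house)
     [([2, 2, 1], 6), ([2, 1, 1, 1], 12), ([1, 1, 1, 1, 1], 42)]"
  by code_simp+

lemma expands_flag:
  "expands column_constraints 5 (edge_constraints flag) [([5], 20), ([4, 1], 12), ([3, 2], 4)]"
  "expands tableau_constraints 5 (edge_constraints flag)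
     [([2, 2, 1], 4), ([2, 1, 1, 1], 16), ([1, 1, 1, 1, 1], 36)]"
  by code_simp+

theorem proposition2p23:
  shows "(\<exists>n (G :: nat pair_pre_digraph) (H :: nat pair_pre_digraph).
            connected_graph_on n G \<and> connected_graph_on n H \<and> G <\<^sub>e H \<and> \<not> G <\<^sub>s H) \<and>
         (\<exists>n (G :: nat pair_pre_digraph) (H :: nat pair_pre_digraph).
            connected_graph_on n G \<and> connected_graph_on n H \<and> G <\<^sub>s H \<and> \<not> G <\<^sub>e H)"
proof
  have connected: "connected_graph_on 5 (graph_of 5 house)" "connected_graph_on 5 (graph_of 5 flag)"
    "connected_graph_on 4 (graph_of 4 diamond)" "connected_graph_on 4 (graph_of 4 square)"
    by (intro connected_graph_of;
        simp add: flag_def house_def square_def diamond_def All_less_Suc numeral_eq_Suc)+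

  \<comment> \<open>The ratio is 20/30 = 2/3, and the difference is 8 times the elementary function
    of (4,1); the coefficient of (3,2) cancels.\<close>
  have "graph_of 5 house \<le>\<^sub>e graph_of 5 flag"
    unfolding le_e_graph_of_iff[OF expands_house(1) expands_flag(1)]
    by (auto simp: coeffs_def)
  moreover have "chromatic_sym (graph_of 5 house) \<noteq> chromatic_sym (graph_of 5 flag)"
    by (rule chromatic_sym_graph_of_neq[OF expands_house(1) expands_flag(1), of "[5]"])
      (simp add: coeffs_def)
  \<comment> \<open>The ratio is 36/42 = 6/7, and the coefficient at (2,2,1) is 4 - 36/7 =
    -8/7.\<close>
  moreover have "\<not> graph_of 5 house \<le>\<^sub>s graph_of 5 flag"
    unfolding le_s_graph_of_iff[OF expands_house(2) expands_flag(2)]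
    by (auto simp: coeffs_def numeral_eq_Suc intro!: exI[of _ "[2, 2, 1]"])
  ultimately show "\<exists>n (G :: nat pair_pre_digraph) (H :: nat pair_pre_digraph).
      connected_graph_on n G \<and> connected_graph_on n H \<and> G <\<^sub>e H \<and> \<not> G <\<^sub>s H"
    using connected by (auto simp: less_e_def less_s_def)

  \<comment> \<open>The ratio is 14/18 = 7/9, which leaves 2 at (2,2) and 2 - 14/9 = 4/9 at
    (2,1,1).\<close>
  have "graph_of 4 diamond \<le>\<^sub>s graph_of 4 square"
    unfolding le_s_graph_of_iff[OF expands_diamond(2) expands_square(2)]
    by (auto simp: coeffs_def numeral_eq_Suc)
  moreover have "chromatic_sym (graph_of 4 diamond) \<noteq> chromatic_sym (graph_of 4 square)"
    by (rule chromatic_sym_graph_of_neq[OF expands_diamond(1) expands_square(1), of "[4]"])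
      (simp add: coeffs_def)
  \<comment> \<open>The ratio is 12/16 = 3/4. Only the diamond has a nonzero coefficient at (3,1),
    so the difference has -3/2 there.\<close>
  moreover have "\<not> graph_of 4 diamond \<le>\<^sub>e graph_of 4 square"
    unfolding le_e_graph_of_iff[OF expands_diamond(1) expands_square(1)]
    by (auto simp: coeffs_def intro!: exI[of _ "[3, 1]"])
  ultimately show "\<exists>n (G :: nat pair_pre_digraph) (H :: nat pair_pre_digraph).
      connected_graph_on n G \<and> connected_graph_on n H \<and> G <\<^sub>s H \<and> \<not> G <\<^sub>e H"
    using connected by (auto simp: less_e_def less_s_def)
qed

end
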